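(* Let $P,Q\in\mathbb Z$ with $Q=\pm1$ and $\Delta=P^2+4Q>0$, and assume the Lucas sequence $U_n=U_n(P,Q)$ is nondegenerate. Let $m,n$ be positive integers. The equation $$\Delta y^2=U_mU_n$$ has a solution $y\in\mathbb Q^\times$ if and only if $[U_m][U_n]=[\Delta]$ in $\mathbb Q^\times/(\mathbb Q^\times)^2$. It has a solution $y\in\mathbb Z$ if and only if, in addition, $U_mU_n/\Delta$ is the square of an integer. Equivalently, it has a solution $y\in\mathbb Z$ if and only if $[U_m][U_n]=[\Delta]$ and the rational square $U_mU_n/\Delta$ is an integer square.
   Context: The Lucas sequence $U_n=U_n(P,Q)$ is defined by $U_0=0$, $U_1=1$, $U_{n+2}=PU_{n+1}+QU_n$. Let $\alpha,\beta$ be the roots of $x^2-Px-Q$. The sequence is nondegenerate if $\alpha/\beta$ is not a root of unity (then $U_n\neq0$ for $n\ge1$). $[x]$ denotes the class of $x\in\mathbb Q^\times$ in $\mathbb Q^\times/(\mathbb Q^\times)^2$. *)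

theory Defs
  imports
    Complex_Main
    "HOL-Computational_Algebra.Polynomial"
    "HOL-Computational_Algebra.Nth_Powers"
    "HOL-Algebra.Multiplicative_Group"
    "HOL-Algebra.Algebraic_Closure_Type"
begin

fun lucas_U :: "int \<Rightarrow> int \<Rightarrow> nat \<Rightarrow> int" where
  "lucas_U P Q 0 = 0"
| "lucas_U P Q (Suc 0) = 1"
| "lucas_U P Q (Suc (Suc n)) = P * lucas_U P Q (Suc n) + Q * lucas_U P Q n"

definition root_of_unity :: "complex \<Rightarrow> bool" where
  "root_of_unity z \<longleftrightarrow> (\<exists>k::nat. k > 0 \<and> z ^ k = 1)"

(* \<alpha>, \<beta> are the roots of x^2 - P x - Q with multiplicity. Exchanging them inverts the
   quotient, so quantifying over both orderings is harmless. The definition is meant for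
   Q \<noteq> 0, where both roots are nonzero. *)
definition lucas_nondegenerate :: "int \<Rightarrow> int \<Rightarrow> bool" where
  "lucas_nondegenerate P Q \<longleftrightarrow>
     (\<forall>\<alpha> \<beta> :: complex.
        [:- of_int Q, - of_int P, 1:] = [:- \<alpha>, 1:] * [:- \<beta>, 1:] \<longrightarrow>
        \<not> root_of_unity (\<alpha> / \<beta>))"

definition rat_mult_group :: "rat monoid" where
  "rat_mult_group = Multiplicative_Group.mult_of ring_of_type_algebra"

definition rat_squares :: "rat set" where
  "rat_squares = (\<lambda>x. x [^]\<^bsub>rat_mult_group\<^esub> (2::nat)) ` carrier rat_mult_group"

definition square_class_group :: "rat set monoid" where
  "square_class_group = rat_mult_group Mod rat_squares"

(* Meaningful for x \<noteq> 0 only. *)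
definition square_class :: "rat \<Rightarrow> rat set" where
  "square_class x = rat_squares #>\<^bsub>rat_mult_group\<^esub> x"

lemma comm_group_rat_mult_group: "comm_group rat_mult_group"
proof (rule group.group_comm_groupI)
  show "group rat_mult_group"
    unfolding rat_mult_group_def by (rule field.field_mult_group[OF field_from_type_algebra])
qed (simp add: rat_mult_group_def ring_of_type_algebra_def)

lemma normal_rat_squares: "rat_squares \<lhd> rat_mult_group"
proof -
  interpret comm_group rat_mult_group by (rule comm_group_rat_mult_group)
  have "(\<lambda>x. x [^]\<^bsub>rat_mult_group\<^esub> (2::nat)) \<in> hom rat_mult_group rat_mult_group"
    by (auto simp: hom_def nat_pow_distrib)
  then have "subgroup rat_squares rat_mult_group"
    unfolding rat_squares_def
    by (intro group_hom.img_is_subgroup) (simp add: group_hom_def group_hom_axioms_def)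
  then show ?thesis
    by (rule subgroup_imp_normal)
qed

end

theory Submission
  imports Defs
begin

text \<open>
  A rational number \<open>y \<noteq> 0\<close> with \<open>\<Delta> y\<^sup>2 = U\<^sub>m U\<^sub>n\<close> exists exactly when \<open>\<Delta>\<close> and \<open>U\<^sub>m U\<^sub>n\<close> have the same
  class modulo squares, provided that both are nonzero. Nondegeneracy gives \<open>U\<^sub>k \<noteq> 0\<close> for \<open>k \<ge> 1\<close>:
  by Binet's formula \<open>(\<alpha> - \<beta>) U\<^sub>k = \<alpha>\<^sup>k - \<beta>\<^sup>k\<close>, so \<open>U\<^sub>k = 0\<close> would make \<open>\<alpha>/\<beta>\<close> a root of unity
  (\<open>lucas_U_nonzero\<close>). Classes multiply like representatives (\<open>square_class_mult\<close>), and
  \<open>[x] = [y]\<close> means that \<open>x = y z\<^sup>2\<close> for some \<open>z \<noteq> 0\<close> (\<open>square_class_eq_iff\<close>). Finally, an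
  integer solution \<open>y\<close> is the same as an integer square root of \<open>U\<^sub>m U\<^sub>n / \<Delta>\<close>; it is nonzero, hence
  also a rational solution.
\<close>

lemma lucas_U_Binet:
  fixes \<alpha> \<beta> :: "'a::comm_ring_1"
  assumes "of_int P = \<alpha> + \<beta>" and "of_int Q = - (\<alpha> * \<beta>)"
  shows "(\<alpha> - \<beta>) * of_int (lucas_U P Q n) = \<alpha> ^ n - \<beta> ^ n"
proof (induction n rule: induct_nat_012)
  case (ge2 n)
  have "(\<alpha> - \<beta>) * of_int (lucas_U P Q (Suc (Suc n))) =
      of_int P * ((\<alpha> - \<beta>) * of_int (lucas_U P Q (Suc n)))
      + of_int Q * ((\<alpha> - \<beta>) * of_int (lucas_U P Q n))"
    by (simp add: algebra_simps)
  also have "\<dots> = (\<alpha> + \<beta>) * (\<alpha> ^ Suc n - \<beta> ^ Suc n) - \<alpha> * \<beta> * (\<alpha> ^ n - \<beta> ^ n)"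
    using ge2 by (simp only: assms) (simp add: algebra_simps)
  also have "\<dots> = \<alpha> ^ Suc (Suc n) - \<beta> ^ Suc (Suc n)"
    by (simp add: algebra_simps)
  finally show ?case .
qed auto

lemma lucas_U_nonzero:
  assumes nondeg: "lucas_nondegenerate P Q" and "Q \<noteq> 0" and "n > 0"
  shows "lucas_U P Q n \<noteq> 0"
proof
  assume zero: "lucas_U P Q n = 0"
  define s where "s = csqrt (of_int P ^ 2 + 4 * of_int Q)"
  define \<alpha> \<beta> where "\<alpha> = (of_int P + s) / 2" and "\<beta> = (of_int P - s) / 2"
  have P: "of_int P = \<alpha> + \<beta>"
    by (simp add: \<alpha>_def \<beta>_def field_simps)
  have "s ^ 2 = of_int P ^ 2 + 4 * of_int Q"
    by (simp add: s_def)
  then have Q: "of_int Q = - (\<alpha> * \<beta>)"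
    by (simp add: \<alpha>_def \<beta>_def field_simps power2_eq_square)
  then have "\<beta> \<noteq> 0"
    using \<open>Q \<noteq> 0\<close> by auto
  have "\<alpha> ^ n = \<beta> ^ n"
    using lucas_U_Binet[OF P Q, of n] zero by simp
  then have "(\<alpha> / \<beta>) ^ n = 1"
    using \<open>\<beta> \<noteq> 0\<close> by (simp add: power_divide)
  then have "root_of_unity (\<alpha> / \<beta>)"
    using \<open>n > 0\<close> by (auto simp: root_of_unity_def)
  moreover have "[:- of_int Q, - of_int P, 1:] = [:- \<alpha>, 1:] * [:- \<beta>, 1:]"
    by (simp add: P Q algebra_simps)
  ultimately show False
    using nondeg by (auto simp: lucas_nondegenerate_def)
qed

lemma carrier_rat_mult_group: "carrier rat_mult_group = - {0}"
  by (auto simp: rat_mult_group_def ring_of_type_algebra_def)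

lemma mult_rat_mult_group: "x \<otimes>\<^bsub>rat_mult_group\<^esub> y = x * y"
  by (simp add: rat_mult_group_def ring_of_type_algebra_def)

lemma rat_squares_eq: "rat_squares = {z\<^sup>2 | z. z \<noteq> 0}"
proof -
  interpret comm_group rat_mult_group by (rule comm_group_rat_mult_group)
  have "x [^]\<^bsub>rat_mult_group\<^esub> (2::nat) = x\<^sup>2" if "x \<in> carrier rat_mult_group" for x
    using that l_one[of x] by (simp add: numeral_2_eq_2 mult_rat_mult_group)
  then show ?thesis
    by (auto simp: rat_squares_def carrier_rat_mult_group)
qed

lemma square_class_eq: "square_class x = {x * z\<^sup>2 | z. z \<noteq> 0}"
  by (auto simp: square_class_def r_coset_def rat_squares_eq mult_rat_mult_group mult.commute)

lemma square_class_mult: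
  assumes "x \<noteq> 0" and "y \<noteq> 0"
  shows "square_class x \<otimes>\<^bsub>square_class_group\<^esub> square_class y = square_class (x * y)"
  using normal.rcos_sum[OF normal_rat_squares, of x y] assms
  by (simp add: square_class_group_def FactGroup_def square_class_def
      carrier_rat_mult_group mult_rat_mult_group)

lemma square_class_eq_iff:
  "square_class x = square_class y \<longleftrightarrow> (\<exists>z. z \<noteq> 0 \<and> x = y * z\<^sup>2)"
proof
  assume "square_class x = square_class y"
  moreover have "x \<in> square_class x"
    by (auto simp: square_class_eq intro: exI[of _ 1])
  ultimately show "\<exists>z. z \<noteq> 0 \<and> x = y * z\<^sup>2"
    by (auto simp: square_class_eq)
next
  assume "\<exists>z. z \<noteq> 0 \<and> x = y * z\<^sup>2"
  then obtain z where z: "z \<noteq> 0" "x = y * z\<^sup>2"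
    by blast
  have "x * w\<^sup>2 = y * (z * w)\<^sup>2" and "y * w\<^sup>2 = x * (w / z)\<^sup>2" for w
    using z by (simp_all add: power_mult_distrib power_divide)
  moreover have "z * w \<noteq> 0" and "w / z \<noteq> 0" if "w \<noteq> 0" for w
    using that z by simp_all
  ultimately show "square_class x = square_class y"
    unfolding square_class_eq by blast
qed

theorem proposition4p1:
  fixes P Q \<Delta> :: int and m n :: nat
  assumes "Q = 1 \<or> Q = - 1"
    and "\<Delta> = P\<^sup>2 + 4 * Q"
    and "\<Delta> > 0"
    and "lucas_nondegenerate P Q"
    and "m > 0" and "n > 0"
  shows
    "((\<exists>y::rat. y \<noteq> 0 \<and> of_int \<Delta> * y\<^sup>2 = of_int (lucas_U P Q m) * of_int (lucas_U P Q n))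
        \<longleftrightarrow> square_class (of_int (lucas_U P Q m)) \<otimes>\<^bsub>square_class_group\<^esub>
              square_class (of_int (lucas_U P Q n)) = square_class (of_int \<Delta>))
     \<and>
     ((\<exists>y::int. \<Delta> * y\<^sup>2 = lucas_U P Q m * lucas_U P Q n)
        \<longleftrightarrow> square_class (of_int (lucas_U P Q m)) \<otimes>\<^bsub>square_class_group\<^esub>
              square_class (of_int (lucas_U P Q n)) = square_class (of_int \<Delta>)
            \<and> (\<exists>k::int. (of_int (lucas_U P Q m) * of_int (lucas_U P Q n) / of_int \<Delta> :: rat)
                        = (of_int k)\<^sup>2))
     \<and>
     ((\<exists>y::int. \<Delta> * y\<^sup>2 = lucas_U P Q m * lucas_U P Q n)
        \<longleftrightarrow> square_class (of_int (lucas_U P Q m)) \<otimes>\<^bsub>square_class_group\<^esub>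
              square_class (of_int (lucas_U P Q n)) = square_class (of_int \<Delta>)
            \<and> is_square (of_int (lucas_U P Q m) * of_int (lucas_U P Q n) / of_int \<Delta> :: rat)
            \<and> (\<exists>k::int. is_square k \<and>
                  (of_int (lucas_U P Q m) * of_int (lucas_U P Q n) / of_int \<Delta> :: rat) = of_int k))"
    (is "(?rat \<longleftrightarrow> ?class) \<and> (?int \<longleftrightarrow> ?class \<and> ?int_root) \<and>
         (?int \<longleftrightarrow> ?class \<and> ?rat_square \<and> ?int_square)")
proof -
  let ?u = "lucas_U P Q m" and ?v = "lucas_U P Q n"
  have "Q \<noteq> 0"
    using assms(1) by auto
  then have nz: "?u \<noteq> 0" "?v \<noteq> 0"
    using lucas_U_nonzero assms(4-6) by blast+
  have rat: "?rat \<longleftrightarrow> ?class"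
    using nz by (auto simp: square_class_mult square_class_eq_iff)
  have quotient: "\<Delta> * y\<^sup>2 = ?u * ?v \<longleftrightarrow> (of_int ?u * of_int ?v / of_int \<Delta> :: rat) = (of_int y)\<^sup>2" for y
  proof -
    have "\<Delta> * y\<^sup>2 = ?u * ?v \<longleftrightarrow> (of_int (\<Delta> * y\<^sup>2) :: rat) = of_int (?u * ?v)"
      by (simp only: of_int_eq_iff)
    then show ?thesis
      using \<open>\<Delta> > 0\<close> by (auto simp: field_simps)
  qed
  have int_imp_class: ?class if ?int
  proof -
    obtain y where y: "\<Delta> * y\<^sup>2 = ?u * ?v"
      using \<open>?int\<close> by blast
    then have "y \<noteq> 0"
      using nz by auto
    moreover have "(of_int \<Delta> * (of_int y)\<^sup>2 :: rat) = of_int ?u * of_int ?v"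
      using y by (metis of_int_mult of_int_power)
    ultimately have ?rat
      by (intro exI[of _ "of_int y"]) simp
    then show ?thesis
      using rat by simp
  qed
  have root: "?int \<longleftrightarrow> ?int_root"
    using quotient by simp
  have square: "?int_root \<longleftrightarrow> ?rat_square \<and> ?int_square"
    by (auto simp: is_nth_power_def) (metis of_int_power)
  show ?thesis
    using rat int_imp_class root square by blast
qed

end
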